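(* Let $\bullet$ be nothing, "$\leq 1$", or "$1$". Let $(p_{ij} \colon X_j \to X_i)_{i \sqsubseteq j \in I}$ be a projective system of topological spaces, with canonical projective limit $X, (p_i)_{i \in I}$. If $\mathbb P_{\mathtt{DP}}^\bullet X$ (with the maps $\mathbb P_{\mathtt{DP}}^\bullet\, p_i$) is a projective limit of $(\mathbb P_{\mathtt{DP}}^\bullet\, p_{ij} \colon \mathbb P_{\mathtt{DP}}^\bullet X_j \to \mathbb P_{\mathtt{DP}}^\bullet X_i)_{i \sqsubseteq j \in I}$ and if $\mathbb P_{\mathtt{AP}}^\bullet X$ (with the maps $\mathbb P_{\mathtt{AP}}^\bullet\, p_i$) is a projective limit of $(\mathbb P_{\mathtt{AP}}^\bullet\, p_{ij} \colon \mathbb P_{\mathtt{AP}}^\bullet X_j \to \mathbb P_{\mathtt{AP}}^\bullet X_i)_{i \sqsubseteq j \in I}$, then $\mathbb P_{\mathtt{ADP}}^\bullet X$ (with the maps $\mathbb P_{\mathtt{ADP}}^\bullet\, p_i$) is a projective limit of $(\mathbb P_{\mathtt{ADP}}^\bullet\, p_{ij} \colon \mathbb P_{\mathtt{ADP}}^\bullet X_j \to \mathbb P_{\mathtt{ADP}}^\bullet X_i)_{i \sqsubseteq j \in I}$.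
   Context: **Projective systems.** A projective system $(p_{ij} \colon X_j \to X_i)_{i \sqsubseteq j \in I}$ consists of a directed preordered set $(I,\sqsubseteq)$, spaces $X_i$, and continuous maps $p_{ij}$ ($i \sqsubseteq j$) with $p_{ii} = \mathrm{id}$ and $p_{ij} \circ p_{jk} = p_{ik}$ for $i \sqsubseteq j \sqsubseteq k$. Its canonical projective limit is $X = \{\vec x \in \prod_{i} X_i \mid p_{ij}(x_j) = x_i \text{ for all } i \sqsubseteq j\}$ with the subspace topology of the product, $p_i$ being projection onto coordinate $i$. Saying that $Y$ with maps $(q_i)_{i\in I}$ is a projective limit of a projective system with canonical limit $Z$ means that $y \mapsto (q_i(y))_{i \in I}$ is a (well-defined) homeomorphism from $Y$ onto $Z$. **Previsions.** $\overline{\mathbb R}_+ = \mathbb R_+ \cup \{\infty\}$. $\mathcal L X$ is the set of lower semicontinuous maps from $X$ to $\overline{\mathbb R}_+$ (continuous for the Scott topology on $\overline{\mathbb R}_+$), ordered pointwise. A prevision on $X$ is a Scott-continuous map $F \colon \mathcal L X \to \overline{\mathbb R}_+$ with $F(ah)=aF(h)$ for all $a \in \mathbb R_+$, $h \in \mathcal L X$. It is sublinear (resp. superlinear) iff $F(h+h') \leq F(h)+F(h')$ (resp. $\geq$) for all $h,h'$; subnormalized (resp. normalized) iff $F(\mathbf 1+h) \leq 1+F(h)$ (resp. $=$) for all $h$, where $\mathbf 1$ is the constant function $1$. $\mathbb P_{\mathtt{DP}}^\bullet X$ (resp. $\mathbb P_{\mathtt{AP}}^\bullet X$) is the space of superlinear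 (resp. sublinear) previsions on $X$, required moreover to be subnormalized if $\bullet$ is "$\leq 1$" and normalized if $\bullet$ is "$1$", with topology generated by $\{F \mid F(h)>r\}$, $h \in \mathcal L X$, $r \in \mathbb R_+$. A continuous map $f \colon X \to Y$ acts by $\mathbb P f(F) = (h \in \mathcal L Y \mapsto F(h \circ f))$. **Forks.** A fork on $X$ is a pair $(F^-,F^+)$ of a superlinear prevision $F^-$ and a sublinear prevision $F^+$ on $X$ such that $F^-(h+h') \leq F^-(h)+F^+(h') \leq F^+(h+h')$ for all $h,h' \in \mathcal L X$. It is subnormalized (resp. normalized) iff both $F^-$ and $F^+$ are. $\mathbb P_{\mathtt{ADP}} X$, $\mathbb P_{\mathtt{ADP}}^{\leq 1} X$, $\mathbb P_{\mathtt{ADP}}^{1} X$ are the sets of forks, subnormalized forks, normalized forks, with the subspace topology from $\mathbb P_{\mathtt{DP}} X \times \mathbb P_{\mathtt{AP}} X$. A continuous map $f$ acts by $(F^-,F^+) \mapsto (\mathbb P f(F^-), \mathbb P f(F^+))$. All these are endofunctors on the category of topological spaces. *)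

theory Defs
  imports "HOL-Analysis.Analysis"
begin

section \<open>Directedness and the Scott topology\<close>

definition directed_in :: "'a set \<Rightarrow> ('a \<Rightarrow> 'a \<Rightarrow> bool) \<Rightarrow> bool" where
  "directed_in D le \<longleftrightarrow> D \<noteq> {} \<and> (\<forall>x\<in>D. \<forall>y\<in>D. \<exists>z\<in>D. le x z \<and> le y z)"

definition scott_open :: "'a::complete_lattice set \<Rightarrow> bool" where
  "scott_open U \<longleftrightarrow>
     (\<forall>x\<in>U. \<forall>y. x \<le> y \<longrightarrow> y \<in> U) \<and>
     (\<forall>D. directed_in D (\<le>) \<longrightarrow> Sup D \<in> U \<longrightarrow> (\<exists>x\<in>D. x \<in> U))"

definition scott_topology :: "'a::complete_lattice topology" where
  "scott_topology = topology scott_open"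

lemma scott_open_up: "scott_open U \<Longrightarrow> x \<in> U \<Longrightarrow> x \<le> y \<Longrightarrow> y \<in> U"
  unfolding scott_open_def by fast

lemma scott_open_meets:
  assumes "scott_open U" "directed_in D (\<le>)" "Sup D \<in> U"
  obtains x where "x \<in> D" "x \<in> U"
proof -
  have "\<exists>x\<in>D. x \<in> U" using assms by (simp add: scott_open_def)
  then show ?thesis using that by (elim bexE)
qed

lemma scott_openI:
  assumes "\<And>x y. x \<in> U \<Longrightarrow> x \<le> y \<Longrightarrow> y \<in> U"
    and "\<And>D. directed_in D (\<le>) \<Longrightarrow> Sup D \<in> U \<Longrightarrow> \<exists>x\<in>D. x \<in> U"
  shows "scott_open U"
  unfolding scott_open_def using assms by (intro conjI allI impI ballI)

lemma istopology_scott_open: "istopology (scott_open :: 'a::complete_lattice set \<Rightarrow> bool)"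
  unfolding istopology_def
proof (intro conjI allI impI)
  fix S T :: "'a set"
  assume S: "scott_open S" and T: "scott_open T"
  show "scott_open (S \<inter> T)"
  proof (rule scott_openI)
    show "y \<in> S \<inter> T" if "x \<in> S \<inter> T" "x \<le> y" for x y
      using that scott_open_up[OF S, of x y] scott_open_up[OF T, of x y] by simp
  next
    fix D :: "'a set"
    assume D: "directed_in D (\<le>)" and sup: "Sup D \<in> S \<inter> T"
    obtain x where x: "x \<in> D" "x \<in> S"
      using scott_open_meets[OF S D] sup by (metis IntD1)
    obtain y where y: "y \<in> D" "y \<in> T"
      using scott_open_meets[OF T D] sup by (metis IntD2)
    obtain z where "z \<in> D" "x \<le> z" "y \<le> z"
      using D x(1) y(1) unfolding directed_in_def by metis
    then show "\<exists>x\<in>D. x \<in> S \<inter> T"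
      using scott_open_up[OF S x(2)] scott_open_up[OF T y(2)] by (intro bexI[of _ z]) simp_all
  qed
next
  fix K :: "'a set set"
  assume K: "\<forall>S\<in>K. scott_open S"
  show "scott_open (\<Union>K)"
  proof (rule scott_openI)
    fix x y assume "x \<in> \<Union>K" "x \<le> y"
    then obtain S where "S \<in> K" "x \<in> S" by (elim UnionE)
    then show "y \<in> \<Union>K" using K \<open>x \<le> y\<close> by (intro UnionI[of S]) (auto intro: scott_open_up)
  next
    fix D :: "'a set"
    assume D: "directed_in D (\<le>)" and "Sup D \<in> \<Union>K"
    then obtain S where S: "S \<in> K" "Sup D \<in> S" by (elim UnionE)
    obtain x where "x \<in> D" "x \<in> S"
      using scott_open_meets[OF _ D S(2)] K S(1) by metis
    then show "\<exists>x\<in>D. x \<in> \<Union>K" using S(1) by (intro bexI[of _ x] UnionI[of S])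
  qed
qed

lemma openin_scott_topology [simp]: "openin scott_topology U \<longleftrightarrow> scott_open U"
  unfolding scott_topology_def topology_inverse'[OF istopology_scott_open] ..

lemma topspace_scott_topology [simp]: "topspace scott_topology = UNIV"
proof -
  have "openin scott_topology (UNIV :: 'a set)"
    by (auto simp: scott_open_def directed_in_def)
  then show ?thesis
    using openin_subset by blast
qed


section \<open>Projective systems and projective limits\<close>

definition projective_system ::
  "'i set \<Rightarrow> ('i \<Rightarrow> 'i \<Rightarrow> bool) \<Rightarrow> ('i \<Rightarrow> 'a topology) \<Rightarrow> ('i \<Rightarrow> 'i \<Rightarrow> 'a \<Rightarrow> 'a) \<Rightarrow> bool" where
  "projective_system I le X p \<longleftrightarrow>
     reflp_on I le \<and> transp_on I le \<and> directed_in I le \<and>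
     (\<forall>i\<in>I. \<forall>j\<in>I. le i j \<longrightarrow> continuous_map (X j) (X i) (p i j)) \<and>
     (\<forall>i\<in>I. \<forall>x\<in>topspace (X i). p i i x = x) \<and>
     (\<forall>i\<in>I. \<forall>j\<in>I. \<forall>k\<in>I. le i j \<longrightarrow> le j k \<longrightarrow>
        (\<forall>x\<in>topspace (X k). p i j (p j k x) = p i k x))"

definition canonical_limit ::
  "'i set \<Rightarrow> ('i \<Rightarrow> 'i \<Rightarrow> bool) \<Rightarrow> ('i \<Rightarrow> 'a topology) \<Rightarrow> ('i \<Rightarrow> 'i \<Rightarrow> 'a \<Rightarrow> 'a) \<Rightarrow> ('i \<Rightarrow> 'a) topology" where
  "canonical_limit I le X p =
     subtopology (product_topology X I)
       {x \<in> \<Pi>\<^sub>E i\<in>I. topspace (X i). \<forall>i\<in>I. \<forall>j\<in>I. le i j \<longrightarrow> p i j (x j) = x i}"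

definition is_projective_limit ::
  "'i set \<Rightarrow> ('i \<Rightarrow> 'i \<Rightarrow> bool) \<Rightarrow> ('i \<Rightarrow> 'a topology) \<Rightarrow> ('i \<Rightarrow> 'i \<Rightarrow> 'a \<Rightarrow> 'a)
    \<Rightarrow> 'y topology \<Rightarrow> ('i \<Rightarrow> 'y \<Rightarrow> 'a) \<Rightarrow> bool" where
  "is_projective_limit I le X p Y q \<longleftrightarrow>
     homeomorphic_map Y (canonical_limit I le X p) (\<lambda>y. \<lambda>i\<in>I. q i y)"


section \<open>Previsions\<close>

text \<open>
  HOL functions are total, so a map on the points of \<open>X\<close> needs a fixed value elsewhere to be
  determined as an object.  For lower semicontinuous maps this value is \<open>0\<close>: pointwise addition,
  scaling and suprema then stay within \<open>LSC X\<close>, and the pointwise order on \<open>LSC X\<close> is the order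
  of the function type.  Previsions are made extensional on \<open>LSC X\<close>.
\<close>

definition LSC :: "'a topology \<Rightarrow> ('a \<Rightarrow> ennreal) set" where
  "LSC X = {h. continuous_map X scott_topology h \<and> (\<forall>x. x \<notin> topspace X \<longrightarrow> h x = 0)}"

text \<open>Directed suprema in \<open>LSC X\<close> are the pointwise ones, as used in \<open>prevision\<close> below.\<close>

lemma LSC_directed_Sup:
  assumes D: "D \<subseteq> LSC X" "directed_in D (\<le>)"
  shows "Sup D \<in> LSC X"
  unfolding LSC_def
proof (intro CollectI conjI allI impI)
  show "continuous_map X scott_topology (Sup D)"
    unfolding continuous_map_def
  proof (intro conjI allI impI)
    show "Sup D \<in> topspace X \<rightarrow> topspace scott_topology" by simp
  next
    fix U :: "ennreal set"
    assume "openin scott_topology U"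
    then have U: "scott_open U" by simp
    have "{x \<in> topspace X. Sup D x \<in> U} = (\<Union>h\<in>D. {x \<in> topspace X. h x \<in> U})"
    proof (intro equalityI subsetI)
      fix x assume x: "x \<in> {x \<in> topspace X. Sup D x \<in> U}"
      have "directed_in ((\<lambda>h. h x) ` D) (\<le>)"
        unfolding directed_in_def
      proof (intro conjI ballI)
        show "(\<lambda>h. h x) ` D \<noteq> {}" using D(2) by (simp add: directed_in_def)
      next
        fix u v assume "u \<in> (\<lambda>h. h x) ` D" "v \<in> (\<lambda>h. h x) ` D"
        then obtain g h where gh: "g \<in> D" "h \<in> D" "u = g x" "v = h x" by blast
        then obtain k where "k \<in> D" "g \<le> k" "h \<le> k"
          using D(2) unfolding directed_in_def by metis
        then show "\<exists>z\<in>(\<lambda>h. h x) ` D. u \<le> z \<and> v \<le> z"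
          using gh by (auto simp: le_fun_def)
      qed
      moreover have "Sup ((\<lambda>h. h x) ` D) \<in> U" using x by simp
      ultimately obtain u where "u \<in> (\<lambda>h. h x) ` D" "u \<in> U"
        by (rule scott_open_meets[OF U])
      then show "x \<in> (\<Union>h\<in>D. {x \<in> topspace X. h x \<in> U})"
        using x by auto
    next
      fix x assume "x \<in> (\<Union>h\<in>D. {x \<in> topspace X. h x \<in> U})"
      then obtain h where h: "h \<in> D" "x \<in> topspace X" "h x \<in> U" by blast
      have "h x \<le> Sup D x" using Sup_upper[OF h(1)] by (rule le_funD)
      then show "x \<in> {x \<in> topspace X. Sup D x \<in> U}"
        using h(2) scott_open_up[OF U h(3)] by simp
    qed
    moreover have "openin X {x \<in> topspace X. h x \<in> U}" if "h \<in> D" for h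
    proof (rule openin_continuous_map_preimage)
      show "continuous_map X scott_topology h"
        using that D(1) by (auto simp: LSC_def)
      show "openin scott_topology U" using U by simp
    qed
    ultimately show "openin X {x \<in> topspace X. Sup D x \<in> U}" by auto
  qed
next
  fix x assume "x \<notin> topspace X"
  then have "\<forall>h\<in>D. h x = 0" using D(1) by (auto simp: LSC_def)
  then have "(SUP h\<in>D. h x) \<le> 0" by (intro SUP_least) simp
  then show "Sup D x = 0" by simp
qed

definition prevision :: "'a topology \<Rightarrow> (('a \<Rightarrow> ennreal) \<Rightarrow> ennreal) \<Rightarrow> bool" where
  "prevision X F \<longleftrightarrow>
     F \<in> extensional (LSC X) \<and>
     mono_on (LSC X) F \<and>
     (\<forall>D. D \<subseteq> LSC X \<longrightarrow> directed_in D (\<le>) \<longrightarrow> F (Sup D) = Sup (F ` D)) \<and>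
     (\<forall>a h. a < \<infinity> \<longrightarrow> h \<in> LSC X \<longrightarrow> F (\<lambda>x. a * h x) = a * F h)"

definition sublinear :: "'a topology \<Rightarrow> (('a \<Rightarrow> ennreal) \<Rightarrow> ennreal) \<Rightarrow> bool" where
  "sublinear X F \<longleftrightarrow> (\<forall>h\<in>LSC X. \<forall>h'\<in>LSC X. F (\<lambda>x. h x + h' x) \<le> F h + F h')"

definition superlinear :: "'a topology \<Rightarrow> (('a \<Rightarrow> ennreal) \<Rightarrow> ennreal) \<Rightarrow> bool" where
  "superlinear X F \<longleftrightarrow> (\<forall>h\<in>LSC X. \<forall>h'\<in>LSC X. F h + F h' \<le> F (\<lambda>x. h x + h' x))"

text \<open>The three possible values of the decoration \<open>\<bullet>\<close>: nothing, \<open>\<le> 1\<close>, \<open>1\<close>.\<close>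

datatype decoration = Plain | Subnormalized | Normalized

fun decorated :: "decoration \<Rightarrow> 'a topology \<Rightarrow> (('a \<Rightarrow> ennreal) \<Rightarrow> ennreal) \<Rightarrow> bool" where
  "decorated Plain X F \<longleftrightarrow> True"
| "decorated Subnormalized X F \<longleftrightarrow>
     (\<forall>h\<in>LSC X. F (\<lambda>x. indicator (topspace X) x + h x) \<le> 1 + F h)"
| "decorated Normalized X F \<longleftrightarrow>
     (\<forall>h\<in>LSC X. F (\<lambda>x. indicator (topspace X) x + h x) = 1 + F h)"

text \<open>
  The set \<open>S\<close> itself has to be added to the subbase: the zero prevision lies in no set
  \<open>{F. r < F h}\<close>, while \<open>topology_generated_by\<close> takes the union of its argument as the carrier.
\<close>

definition prevision_topology ::
  "'a topology \<Rightarrow> (('a \<Rightarrow> ennreal) \<Rightarrow> ennreal) set \<Rightarrow> (('a \<Rightarrow> ennreal) \<Rightarrow> ennreal) topology" where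
  "prevision_topology X S =
     topology_generated_by (insert S {{F \<in> S. r < F h} | h r. h \<in> LSC X \<and> r < \<infinity>})"

definition P_DP :: "decoration \<Rightarrow> 'a topology \<Rightarrow> (('a \<Rightarrow> ennreal) \<Rightarrow> ennreal) topology" where
  "P_DP b X = prevision_topology X {F. prevision X F \<and> superlinear X F \<and> decorated b X F}"

definition P_AP :: "decoration \<Rightarrow> 'a topology \<Rightarrow> (('a \<Rightarrow> ennreal) \<Rightarrow> ennreal) topology" where
  "P_AP b X = prevision_topology X {F. prevision X F \<and> sublinear X F \<and> decorated b X F}"

definition P_map ::
  "'a topology \<Rightarrow> 'b topology \<Rightarrow> ('a \<Rightarrow> 'b) \<Rightarrow> (('a \<Rightarrow> ennreal) \<Rightarrow> ennreal) \<Rightarrow> (('b \<Rightarrow> ennreal) \<Rightarrow> ennreal)" where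
  "P_map X Y f F = (\<lambda>h\<in>LSC Y. F (\<lambda>x. if x \<in> topspace X then h (f x) else 0))"


section \<open>Forks\<close>

definition fork ::
  "'a topology \<Rightarrow> (('a \<Rightarrow> ennreal) \<Rightarrow> ennreal) \<times> (('a \<Rightarrow> ennreal) \<Rightarrow> ennreal) \<Rightarrow> bool" where
  "fork X = (\<lambda>(Fm, Fp).
     prevision X Fm \<and> superlinear X Fm \<and> prevision X Fp \<and> sublinear X Fp \<and>
     (\<forall>h\<in>LSC X. \<forall>h'\<in>LSC X.
        Fm (\<lambda>x. h x + h' x) \<le> Fm h + Fp h' \<and> Fm h + Fp h' \<le> Fp (\<lambda>x. h x + h' x)))"

definition P_ADP ::
  "decoration \<Rightarrow> 'a topology \<Rightarrow> ((('a \<Rightarrow> ennreal) \<Rightarrow> ennreal) \<times> (('a \<Rightarrow> ennreal) \<Rightarrow> ennreal)) topology" where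
  "P_ADP b X = subtopology (prod_topology (P_DP Plain X) (P_AP Plain X))
     {(Fm, Fp). fork X (Fm, Fp) \<and> decorated b X Fm \<and> decorated b X Fp}"

definition fork_map ::
  "'a topology \<Rightarrow> 'b topology \<Rightarrow> ('a \<Rightarrow> 'b)
    \<Rightarrow> (('a \<Rightarrow> ennreal) \<Rightarrow> ennreal) \<times> (('a \<Rightarrow> ennreal) \<Rightarrow> ennreal)
    \<Rightarrow> (('b \<Rightarrow> ennreal) \<Rightarrow> ennreal) \<times> (('b \<Rightarrow> ennreal) \<Rightarrow> ennreal)" where
  "fork_map X Y f = map_prod (P_map X Y f) (P_map X Y f)"

end

theory Submission
  imports Defs
begin

text \<open>
  A fork is a pair of previsions subject to inequalities, and its space carries the subspace
  topology of a product.  Projective limits commute with products and with subspaces, provided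
  that a point of the limit lies in the subspace exactly when all its components do
  (\<open>is_projective_limit_subspace_prod\<close>).  So the two assumed homeomorphisms combine to the required
  one as soon as a pair \<open>(F\<^sup>-, F\<^sup>+)\<close> of previsions on the limit \<open>L\<close> is known to be a fork if
  and only if each of its images on the spaces \<open>X\<^sub>i\<close> is one.

  Forks are mapped to forks because precomposition with a continuous map preserves sums
  (\<open>fork_P_map\<close>).  The converse (\<open>fork_canonical_limitI\<close>) is the point of the proof.  The fork
  inequalities for the images only speak about functions of the form \<open>g \<circ> p\<^sub>i\<close>, but these are
  dense enough: since \<open>I\<close> is directed, the sets \<open>p\<^sub>i\<inverse>(V)\<close> with \<open>V\<close> open in \<open>X\<^sub>i\<close> form a base of
  \<open>L\<close>, so every lower semicontinuous \<open>h\<close> is the supremum of the functions \<open>h\<^sub>i \<circ> p\<^sub>i\<close>, where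
  \<open>h\<^sub>i\<close> is the largest lower semicontinuous function on \<open>X\<^sub>i\<close> with \<open>h\<^sub>i \<circ> p\<^sub>i \<le> h\<close>
  (\<open>LSC_canonical_limit_SUP\<close>).  Choosing the largest one makes the family monotone in \<open>i\<close>, so it is
  directed and \<open>h + h'\<close> is the directed supremum of \<open>(h\<^sub>i + h'\<^sub>i) \<circ> p\<^sub>i\<close>.  Scott continuity of
  \<open>F\<^sup>-\<close> and \<open>F\<^sup>+\<close> then carries the inequalities to the limit.

  The decorations need no argument of their own: decorated forks are the forks among the pairs of
  decorated previsions (\<open>P_ADP_alt\<close>).
\<close>

section \<open>Lower semicontinuous maps\<close>

lemma scott_open_greaterThan: "scott_open {r::ennreal<..}"
  by (rule scott_openI) (auto simp: less_Sup_iff)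

text \<open>
  An upper set is determined by its infimum up to whether it contains it.  If a Scott open set
  contained its infimum \<open>s > 0\<close>, it would meet the directed set of all elements below \<open>s\<close>, whose
  supremum is \<open>s\<close>.
\<close>

lemma scott_open_ennreal_cases:
  fixes U :: "ennreal set"
  assumes U: "scott_open U"
  shows "U = {} \<or> U = UNIV \<or> U = {Inf U<..}"
proof (cases "U = {} \<or> Inf U = 0 \<and> 0 \<in> U")
  case True
  then show ?thesis using scott_open_up[OF U, of 0] by auto
next
  case False
  have "Inf U \<notin> U"
  proof
    assume inf: "Inf U \<in> U"
    then have pos: "0 < Inf U" using False by (auto simp: zero_less_iff_neq_zero)
    have "directed_in {..<Inf U} (\<le>)"
      unfolding directed_in_def
    proof (intro conjI ballI)
      show "{..<Inf U} \<noteq> {}" using pos by auto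
      fix x y assume "x \<in> {..<Inf U}" "y \<in> {..<Inf U}"
      then show "\<exists>z\<in>{..<Inf U}. x \<le> z \<and> y \<le> z" by (intro bexI[of _ "max x y"]) auto
    qed
    moreover have "Sup {..<Inf U} = Inf U"
      using pos by (intro Sup_lessThan)
    ultimately obtain x where "x < Inf U" "x \<in> U"
      using scott_open_meets[OF U, of "{..<Inf U}"] inf by auto
    then show False using Inf_lower[of x U] by simp
  qed
  have "U = {Inf U<..}"
  proof (intro equalityI subsetI)
    fix x assume "x \<in> U"
    then have "Inf U \<le> x" "x \<noteq> Inf U" using \<open>Inf U \<notin> U\<close> by (auto intro: Inf_lower)
    then show "x \<in> {Inf U<..}" by simp
  next
    fix x assume "x \<in> {Inf U<..}"
    then obtain y where "y \<in> U" "y < x" by (auto simp: Inf_less_iff)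
    then show "x \<in> U" using scott_open_up[OF U] by (meson less_imp_le)
  qed
  then show ?thesis by blast
qed

lemma LSC_iff:
  "h \<in> LSC X \<longleftrightarrow>
     (\<forall>r. openin X {x \<in> topspace X. r < h x}) \<and> (\<forall>x. x \<notin> topspace X \<longrightarrow> h x = 0)"
proof -
  have "continuous_map X scott_topology h \<longleftrightarrow> (\<forall>r. openin X {x \<in> topspace X. r < h x})"
  proof
    assume h: "continuous_map X scott_topology h"
    show "\<forall>r. openin X {x \<in> topspace X. r < h x}"
    proof
      fix r
      have "openin X {x \<in> topspace X. h x \<in> {r<..}}"
        by (rule openin_continuous_map_preimage[OF h]) (simp add: scott_open_greaterThan)
      then show "openin X {x \<in> topspace X. r < h x}" by simp
    qed
  next
    assume h: "\<forall>r. openin X {x \<in> topspace X. r < h x}"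
    show "continuous_map X scott_topology h"
      unfolding continuous_map_def
    proof (intro conjI allI impI)
      fix U :: "ennreal set"
      assume "openin scott_topology U"
      then consider "U = {}" | "U = UNIV" | r where "U = {r<..}"
        using scott_open_ennreal_cases[of U] by auto
      then show "openin X {x \<in> topspace X. h x \<in> U}"
        using h by cases auto
    qed simp
  qed
  then show ?thesis by (simp add: LSC_def)
qed

lemma LSC_openin: "h \<in> LSC X \<Longrightarrow> openin X {x \<in> topspace X. r < h x}"
  by (simp add: LSC_iff)

lemma LSC_outside: "h \<in> LSC X \<Longrightarrow> x \<notin> topspace X \<Longrightarrow> h x = 0"
  by (simp add: LSC_iff)

lemma LSC_max:
  assumes "g \<in> LSC X" "h \<in> LSC X"
  shows "(\<lambda>x. max (g x) (h x)) \<in> LSC X"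
proof -
  have "{x \<in> topspace X. r < max (g x) (h x)} =
      {x \<in> topspace X. r < g x} \<union> {x \<in> topspace X. r < h x}" for r
    by (auto simp: less_max_iff_disj)
  then show ?thesis
    using assms by (simp add: LSC_iff openin_Un)
qed

text \<open>
  Where both summands are positive, \<open>u + v\<close> is the supremum of \<open>a + b\<close> over \<open>a < u\<close>, \<open>b < v\<close>, so
  \<open>r < u + v\<close> is witnessed by such a pair.  A summand equal to \<open>0\<close> has nothing strictly below it;
  there \<open>r\<close> is already exceeded by the other summand.
\<close>

lemma LSC_add:
  assumes g: "g \<in> LSC X" and h: "h \<in> LSC X"
  shows "(\<lambda>x. g x + h x) \<in> LSC X"
  unfolding LSC_iff
proof (intro conjI allI impI)
  fix r
  define W where "W a b = {x \<in> topspace X. a < g x} \<inter> {x \<in> topspace X. b < h x}" for a b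
  have split: "\<exists>a b. a < u \<and> b < v \<and> r < a + b"
    if "r < u + v" "0 < u" "0 < v" for u v :: ennreal
  proof -
    have ne: "{..<u} \<noteq> {}" "{..<v} \<noteq> {}" using that by auto
    have "u + v = (SUP a\<in>{..<u}. SUP b\<in>{..<v}. a + b)"
    proof -
      have "(SUP b\<in>{..<v}. a + b) = a + v" for a
        using ennreal_SUP_add_right[OF ne(2), of a "\<lambda>b. b"] Sup_lessThan[of v] that by simp
      moreover have "(SUP a\<in>{..<u}. a + v) = u + v"
        using ennreal_SUP_add_left[OF ne(1), of "\<lambda>b. b" v] Sup_lessThan[of u] that by simp
      ultimately show ?thesis by simp
    qed
    then show ?thesis
      using that(1) by (auto simp: less_SUP_iff)
  qed
  have "{x \<in> topspace X. r < g x + h x} =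
      {x \<in> topspace X. r < g x} \<union> {x \<in> topspace X. r < h x} \<union> (\<Union>(a, b)\<in>{(a, b). r < a + b}. W a b)"
  proof (intro equalityI subsetI)
    fix x assume x: "x \<in> {x \<in> topspace X. r < g x + h x}"
    show "x \<in> {x \<in> topspace X. r < g x} \<union> {x \<in> topspace X. r < h x} \<union> (\<Union>(a, b)\<in>{(a, b). r < a + b}. W a b)"
    proof (cases "g x = 0 \<or> h x = 0")
      case True
      then show ?thesis using x by auto
    next
      case False
      then obtain a b where "a < g x" "b < h x" "r < a + b"
        using split[of "g x" "h x"] x by (auto simp: zero_less_iff_neq_zero)
      then show ?thesis using x by (auto simp: W_def)
    qed
  next
    fix x assume "x \<in> {x \<in> topspace X. r < g x} \<union> {x \<in> topspace X. r < h x} \<union> (\<Union>(a, b)\<in>{(a, b). r < a + b}. W a b)"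
    then consider "x \<in> topspace X" "r < g x" | "x \<in> topspace X" "r < h x"
      | a b where "x \<in> topspace X" "r < a + b" "a < g x" "b < h x"
      by (auto simp: W_def)
    then show "x \<in> {x \<in> topspace X. r < g x + h x}"
    proof cases
      case 1
      then show ?thesis by (auto intro: less_le_trans[OF _ add_increasing2[OF zero_le order_refl]])
    next
      case 2
      then show ?thesis by (auto intro: less_le_trans[OF _ add_increasing[OF zero_le order_refl]])
    next
      case 3
      then show ?thesis by (auto intro: less_le_trans[OF _ add_mono])
    qed
  qed
  moreover have "openin X (W a b)" for a b
    unfolding W_def using LSC_openin[OF g] LSC_openin[OF h] by (rule openin_Int)
  ultimately show "openin X {x \<in> topspace X. r < g x + h x}"
    using LSC_openin[OF g] LSC_openin[OF h] by (auto intro!: openin_Un openin_clauses(3))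
qed (simp add: LSC_outside[OF g] LSC_outside[OF h])

lemma LSC_step:
  assumes "openin X U"
  shows "(\<lambda>x. if x \<in> U then a else 0) \<in> LSC X"
proof -
  have "{x \<in> topspace X. r < (if x \<in> U then a else 0)} = (if r < a then U else {})" for r
    using openin_subset[OF assms] by auto
  then show ?thesis
    using openin_subset[OF assms] assms by (auto simp: LSC_iff)
qed

section \<open>Pullback and pushforward of lower semicontinuous maps\<close>

text \<open>
  Precomposition with \<open>f\<close>, with the value \<open>0\<close> off the space that membership in \<open>LSC X\<close> demands.
\<close>

definition pullback :: "'a topology \<Rightarrow> ('a \<Rightarrow> 'b) \<Rightarrow> ('b \<Rightarrow> ennreal) \<Rightarrow> 'a \<Rightarrow> ennreal" where
  "pullback X f h = (\<lambda>x. if x \<in> topspace X then h (f x) else 0)"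

lemma pullback_LSC:
  assumes f: "continuous_map X Y f" and h: "h \<in> LSC Y"
  shows "pullback X f h \<in> LSC X"
proof -
  have "openin X {x \<in> topspace X. f x \<in> {y \<in> topspace Y. r < h y}}" for r
    using openin_continuous_map_preimage[OF f LSC_openin[OF h]] .
  moreover have "{x \<in> topspace X. r < pullback X f h x} =
      {x \<in> topspace X. f x \<in> {y \<in> topspace Y. r < h y}}" for r
    using continuous_map_image_subset_topspace[OF f] by (auto simp: pullback_def)
  ultimately show ?thesis by (simp add: LSC_iff) (simp add: pullback_def)
qed

lemma pullback_add: "pullback X f (\<lambda>x. g x + h x) = (\<lambda>x. pullback X f g x + pullback X f h x)"
  by (auto simp: pullback_def)

lemma P_map_apply: "h \<in> LSC Y \<Longrightarrow> P_map X Y f F h = F (pullback X f h)"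
  by (simp add: P_map_def pullback_def)

text \<open>
  The right adjoint of the pullback: the largest lower semicontinuous map whose pullback stays
  below \<open>h\<close>.  It exists because \<open>LSC Y\<close> is closed under directed suprema and binary maxima.
\<close>

definition pushforward :: "'a topology \<Rightarrow> 'b topology \<Rightarrow> ('a \<Rightarrow> 'b) \<Rightarrow> ('a \<Rightarrow> ennreal) \<Rightarrow> 'b \<Rightarrow> ennreal" where
  "pushforward X Y f h = Sup {g \<in> LSC Y. pullback X f g \<le> h}"

lemma pushforward_greatest:
  "g \<in> LSC Y \<Longrightarrow> pullback X f g \<le> h \<Longrightarrow> g \<le> pushforward X Y f h"
  unfolding pushforward_def by (rule Sup_upper) simp

lemma pushforward_LSC: "pushforward X Y f h \<in> LSC Y"
  unfolding pushforward_def
proof (rule LSC_directed_Sup)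
  show "directed_in {g \<in> LSC Y. pullback X f g \<le> h} (\<le>)"
    unfolding directed_in_def
  proof (intro conjI ballI)
    have "(\<lambda>_. 0) \<in> {g \<in> LSC Y. pullback X f g \<le> h}"
      by (simp add: LSC_iff pullback_def le_fun_def)
    then show "{g \<in> LSC Y. pullback X f g \<le> h} \<noteq> {}" by blast
  next
    fix g g' assume "g \<in> {g \<in> LSC Y. pullback X f g \<le> h}" "g' \<in> {g \<in> LSC Y. pullback X f g \<le> h}"
    then show "\<exists>k\<in>{g \<in> LSC Y. pullback X f g \<le> h}. g \<le> k \<and> g' \<le> k"
      by (intro bexI[of _ "\<lambda>x. max (g x) (g' x)"])
        (auto simp: LSC_max le_fun_def pullback_def split: if_splits)
  qed
qed auto

lemma pullback_pushforward_le: "pullback X f (pushforward X Y f h) \<le> h"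
proof (rule le_funI)
  fix x
  have "g (f x) \<le> h x" if "x \<in> topspace X" "pullback X f g \<le> h" for g
    using le_funD[OF that(2), of x] that(1) by (simp add: pullback_def)
  then show "pullback X f (pushforward X Y f h) x \<le> h x"
    by (auto simp: pullback_def pushforward_def intro!: SUP_least)
qed

section \<open>Approximating lower semicontinuous maps on a projective limit\<close>

lemma canonical_limit_topspace:
  "topspace (canonical_limit I le X p) =
     {x \<in> \<Pi>\<^sub>E i\<in>I. topspace (X i). \<forall>i\<in>I. \<forall>j\<in>I. le i j \<longrightarrow> p i j (x j) = x i}"
  by (auto simp: canonical_limit_def)

lemma continuous_map_canonical_limit_projection:
  "i \<in> I \<Longrightarrow> continuous_map (canonical_limit I le X p) (X i) (\<lambda>x. x i)"
  unfolding canonical_limit_def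
  by (intro continuous_map_from_subtopology continuous_map_product_projection)

lemma directed_in_finite_upper_bound:
  assumes I: "directed_in I le" "transp_on I le" and J: "finite J" "J \<subseteq> I"
  shows "\<exists>k\<in>I. \<forall>j\<in>J. le j k"
  using J
proof (induction J rule: finite_induct)
  case empty
  then show ?case using I by (auto simp: directed_in_def)
next
  case (insert j J)
  then obtain k where k: "k \<in> I" "\<forall>j\<in>J. le j k" by auto
  obtain l where "l \<in> I" "le j l" "le k l"
    using I(1) k(1) insert.prems unfolding directed_in_def by blast
  moreover have "le j' l" if "j' \<in> J" for j'
    using transp_onD[OF I(2), of j' k l] k that insert.prems \<open>l \<in> I\<close> \<open>le k l\<close> by auto
  ultimately show ?case by auto
qed

text \<open>
  A basic open set of the product constrains finitely many coordinates.  On the limit all of these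
  are functions of a single coordinate whose index lies above them, so one coordinate suffices.
\<close>

lemma canonical_limit_basis:
  assumes sys: "projective_system I le X p"
    and U: "openin (canonical_limit I le X p) U" and x: "x \<in> U"
  obtains i V where "i \<in> I" "openin (X i) V" "x i \<in> V"
    "\<And>y. y \<in> topspace (canonical_limit I le X p) \<Longrightarrow> y i \<in> V \<Longrightarrow> y \<in> U"
proof -
  let ?L = "topspace (canonical_limit I le X p)"
  obtain T where T: "openin (product_topology X I) T" "U = T \<inter> ?L"
    using U unfolding canonical_limit_def by (auto simp: openin_subtopology)
  have xL: "x \<in> ?L" using T x by auto
  obtain B where B: "x \<in> (\<Pi>\<^sub>E i\<in>I. B i)" "\<And>i. openin (X i) (B i)"
      "finite {i. B i \<noteq> topspace (X i)}" "(\<Pi>\<^sub>E i\<in>I. B i) \<subseteq> T"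
    using product_topology_open_contains_basis[OF T(1), of x] T x by auto
  define J where "J = {i\<in>I. B i \<noteq> topspace (X i)}"
  have J: "finite J" "J \<subseteq> I" using B(3) by (auto simp: J_def)
  have "directed_in I le" "transp_on I le" using sys by (auto simp: projective_system_def)
  then obtain k where k: "k \<in> I" "\<forall>j\<in>J. le j k"
    using directed_in_finite_upper_bound J by metis
  define V where "V = topspace (X k) \<inter> (\<Inter>j\<in>J. {z \<in> topspace (X k). p j k z \<in> B j})"
  have "openin (X k) {z \<in> topspace (X k). p j k z \<in> B j}" if "j \<in> J" for j
    using sys that k J(2) B(2) by (intro openin_continuous_map_preimage) (auto simp: projective_system_def)
  then have "openin (X k) V"
    unfolding V_def using J(1) by (intro openin_Int_Inter) auto
  moreover have comp: "p j k (y k) = y j" if "y \<in> ?L" "j \<in> J" for y j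
    using that k J(2) by (auto simp: canonical_limit_topspace)
  have "x k \<in> V"
    using xL k comp[OF xL] B(1) J(2) by (auto simp: V_def canonical_limit_topspace PiE_iff)
  moreover have "y \<in> U" if "y \<in> ?L" "y k \<in> V" for y
  proof -
    have "y i \<in> B i" if "i \<in> I" for i
      using \<open>y \<in> ?L\<close> \<open>y k \<in> V\<close> comp[OF \<open>y \<in> ?L\<close>] that
      by (cases "i \<in> J") (auto simp: J_def V_def canonical_limit_topspace PiE_iff)
    then have "y \<in> (\<Pi>\<^sub>E i\<in>I. B i)"
      using \<open>y \<in> ?L\<close> by (auto simp: canonical_limit_topspace PiE_iff)
    then show ?thesis using B(4) T(2) that(1) by auto
  qed
  ultimately show thesis using that k(1) by blast
qed

text \<open>
  The \<open>i\<close>-th approximant of \<open>h\<close> also factors through \<open>X j\<close>, and the \<open>j\<close>-th one is the largest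
  that does.
\<close>

lemma pullback_pushforward_mono:
  assumes sys: "projective_system I le X p" and ij: "i \<in> I" "j \<in> I" "le i j"
  defines "L \<equiv> canonical_limit I le X p"
  shows "pullback L (\<lambda>x. x i) (pushforward L (X i) (\<lambda>x. x i) h)
    \<le> pullback L (\<lambda>x. x j) (pushforward L (X j) (\<lambda>x. x j) h)"
proof -
  let ?g = "pullback (X j) (p i j) (pushforward L (X i) (\<lambda>x. x i) h)"
  have "continuous_map (X j) (X i) (p i j)"
    using sys ij by (auto simp: projective_system_def)
  then have LSC: "?g \<in> LSC (X j)" by (rule pullback_LSC) (rule pushforward_LSC)
  have eq: "pullback L (\<lambda>x. x j) ?g = pullback L (\<lambda>x. x i) (pushforward L (X i) (\<lambda>x. x i) h)"
    using ij by (auto simp: pullback_def L_def canonical_limit_topspace PiE_iff fun_eq_iff)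
  then have "?g \<le> pushforward L (X j) (\<lambda>x. x j) h"
    using LSC by (intro pushforward_greatest) (simp_all add: pullback_pushforward_le)
  then show ?thesis
    unfolding eq[symmetric] by (auto simp: pullback_def le_fun_def)
qed

text \<open>
  If \<open>r < h x\<close>, then a basic neighbourhood \<open>{y. y i \<in> V}\<close> of \<open>x\<close> lies in \<open>{y. r < h y}\<close>, and the
  step function with value \<open>r\<close> on \<open>V\<close> is one of the competitors defining the \<open>i\<close>-th pushforward.
\<close>

lemma LSC_canonical_limit_SUP:
  assumes sys: "projective_system I le X p"
  defines "L \<equiv> canonical_limit I le X p"
  assumes h: "h \<in> LSC L"
  shows "(SUP i\<in>I. pullback L (\<lambda>x. x i) (pushforward L (X i) (\<lambda>x. x i) h) x) = h x"
proof (rule antisym)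
  show "(SUP i\<in>I. pullback L (\<lambda>x. x i) (pushforward L (X i) (\<lambda>x. x i) h) x) \<le> h x"
    by (rule SUP_least) (rule le_funD[OF pullback_pushforward_le])
  show "h x \<le> (SUP i\<in>I. pullback L (\<lambda>x. x i) (pushforward L (X i) (\<lambda>x. x i) h) x)"
  proof (cases "x \<in> topspace L")
    case True
    show ?thesis
    proof (rule dense_le)
      fix r assume "r < h x"
      then have "x \<in> {x \<in> topspace L. r < h x}" using True by simp
      then obtain i V where i: "i \<in> I" and V: "openin (X i) V" "x i \<in> V"
        and sub: "\<And>y. y \<in> topspace L \<Longrightarrow> y i \<in> V \<Longrightarrow> y \<in> {x \<in> topspace L. r < h x}"
        using canonical_limit_basis[OF sys LSC_openin[OF h, unfolded L_def]] unfolding L_def by blast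
      have "(\<lambda>z. if z \<in> V then r else 0) \<le> pushforward L (X i) (\<lambda>x. x i) h"
        using sub by (intro pushforward_greatest LSC_step V) (auto simp: pullback_def le_fun_def less_imp_le)
      then have "r \<le> pushforward L (X i) (\<lambda>x. x i) h (x i)"
        using V(2) le_funD[of "\<lambda>z. if z \<in> V then r else 0" _ "x i"] by simp
      then show "r \<le> (SUP i\<in>I. pullback L (\<lambda>x. x i) (pushforward L (X i) (\<lambda>x. x i) h) x)"
        using True by (intro SUP_upper2[OF i]) (simp add: pullback_def)
    qed
  qed (simp add: LSC_outside[OF h])
qed

lemma prevision_mono: "prevision X F \<Longrightarrow> g \<in> LSC X \<Longrightarrow> h \<in> LSC X \<Longrightarrow> g \<le> h \<Longrightarrow> F g \<le> F h"
  by (auto simp: prevision_def dest: mono_onD)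

lemma prevision_SUP:
  assumes F: "prevision X F" and I: "directed_in I le"
    and A: "\<And>i. i \<in> I \<Longrightarrow> A i \<in> LSC X"
    and mono: "\<And>i j. i \<in> I \<Longrightarrow> j \<in> I \<Longrightarrow> le i j \<Longrightarrow> A i \<le> A j"
  shows "F (\<lambda>x. SUP i\<in>I. A i x) = (SUP i\<in>I. F (A i))"
proof -
  have "directed_in (A ` I) (\<le>)"
    unfolding directed_in_def
  proof (intro conjI ballI)
    show "A ` I \<noteq> {}" using I by (simp add: directed_in_def)
    fix u v assume "u \<in> A ` I" "v \<in> A ` I"
    then obtain i j where ij: "i \<in> I" "j \<in> I" "u = A i" "v = A j" by blast
    then obtain k where "k \<in> I" "le i k" "le j k" using I unfolding directed_in_def by metis
    then show "\<exists>w\<in>A ` I. u \<le> w \<and> v \<le> w" using ij mono by blast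
  qed
  then have "F (Sup (A ` I)) = Sup (F ` A ` I)"
    using F A unfolding prevision_def by blast
  moreover have "Sup (A ` I) = (\<lambda>x. SUP i\<in>I. A i x)"
    by (auto simp: fun_eq_iff image_image)
  ultimately show ?thesis by (simp add: image_image)
qed

section \<open>The fork inequalities on a projective limit\<close>

lemma fork_P_map:
  assumes f: "continuous_map X Y f" and FF: "fork X (Fm, Fp)"
    and "prevision Y (P_map X Y f Fm)" "superlinear Y (P_map X Y f Fm)"
    and "prevision Y (P_map X Y f Fp)" "sublinear Y (P_map X Y f Fp)"
  shows "fork Y (P_map X Y f Fm, P_map X Y f Fp)"
  using assms(2-) by (auto simp: fork_def P_map_apply LSC_add pullback_add pullback_LSC[OF f])

text \<open>
  A fork inequality on the limit for \<open>h\<close> and \<open>h'\<close> is the directed supremum of the fork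
  inequalities of the components for the pushforwards of \<open>h\<close> and \<open>h'\<close>.  This is where Scott
  continuity enters, once for \<open>h\<close>, \<open>h'\<close> separately and once for \<open>h + h'\<close>; addition commutes with
  the suprema because both families are monotone in the same directed index.
\<close>

lemma fork_canonical_limitI:
  assumes sys: "projective_system I le X p"
  defines "L \<equiv> canonical_limit I le X p"
  assumes Fm: "prevision L Fm" "superlinear L Fm" and Fp: "prevision L Fp" "sublinear L Fp"
    and forks: "\<And>i. i \<in> I \<Longrightarrow> fork (X i) (P_map L (X i) (\<lambda>x. x i) Fm, P_map L (X i) (\<lambda>x. x i) Fp)"
      (is "\<And>i. _ \<Longrightarrow> fork _ (?Fm i, ?Fp i)")
  shows "fork L (Fm, Fp)"
proof -
  have dir: "directed_in I le" using sys by (auto simp: projective_system_def)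
  define A where "A h i = pushforward L (X i) (\<lambda>x. x i) h" for h i
  define B where "B h i = pullback L (\<lambda>x. x i) (A h i)" for h i
  have A: "A h i \<in> LSC (X i)" for h i unfolding A_def by (rule pushforward_LSC)
  have B: "B h i \<in> LSC L" if "i \<in> I" for h i 
    unfolding B_def L_def using that A
    by (intro pullback_LSC[OF continuous_map_canonical_limit_projection])
  have B_mono: "B h i \<le> B h j" if "i \<in> I" "j \<in> I" "le i j" for h i j
    unfolding B_def A_def L_def using sys that by (rule pullback_pushforward_mono)
  have B_le: "B h i \<le> h" for h i unfolding B_def A_def by (rule pullback_pushforward_le)
  have B_SUP: "(SUP i\<in>I. B h i x) = h x" if "h \<in> LSC L" for h x
    using LSC_canonical_limit_SUP[OF sys] that unfolding B_def A_def L_def by blast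
  have F_SUP: "F h = (SUP i\<in>I. F (B h i))" if "prevision L F" "h \<in> LSC L" for F h
    using prevision_SUP[OF that(1) dir, of "B h"] B B_mono B_SUP[OF that(2)] by simp
  have F_SUP_add: "F (\<lambda>x. h x + h' x) = (SUP i\<in>I. F (\<lambda>x. B h i x + B h' i x))"
    if "prevision L F" "h \<in> LSC L" "h' \<in> LSC L" for F h h'
  proof -
    have "(SUP i\<in>I. B h i x + B h' i x) = h x + h' x" for x
    proof -
      have "(SUP i\<in>I. B h i x + B h' i x) = (SUP i\<in>I. B h i x) + (SUP i\<in>I. B h' i x)"
      proof (rule SUP_add_directed_ennreal)
        fix i j assume "i \<in> I" "j \<in> I"
        then obtain k where "k \<in> I" "le i k" "le j k" using dir by (auto simp: directed_in_def)
        then show "\<exists>k\<in>I. B h i x + B h' j x \<le> B h k x + B h' k x"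
          using \<open>i \<in> I\<close> \<open>j \<in> I\<close> by (intro bexI[of _ k] add_mono le_funD[OF B_mono])
      qed
      then show ?thesis using that by (simp add: B_SUP)
    qed
    moreover have "F (\<lambda>x. SUP i\<in>I. B h i x + B h' i x) = (SUP i\<in>I. F (\<lambda>x. B h i x + B h' i x))"
      using B by (intro prevision_SUP[OF that(1) dir])
        (auto intro!: LSC_add add_mono le_funI le_funD[OF B_mono])
    ultimately show ?thesis by simp
  qed
  have step: "Fm (\<lambda>x. B h i x + B h' i x) \<le> Fm (B h i) + Fp (B h' i)"
      "Fm (B h i) + Fp (B h' i) \<le> Fp (\<lambda>x. B h i x + B h' i x)" if "i \<in> I" for h h' i
  proof -
    have "?Fm i (\<lambda>x. A h i x + A h' i x) \<le> ?Fm i (A h i) + ?Fp i (A h' i)"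
      "?Fm i (A h i) + ?Fp i (A h' i) \<le> ?Fp i (\<lambda>x. A h i x + A h' i x)"
      using forks[OF that] A by (auto simp: fork_def)
    then show "Fm (\<lambda>x. B h i x + B h' i x) \<le> Fm (B h i) + Fp (B h' i)"
      "Fm (B h i) + Fp (B h' i) \<le> Fp (\<lambda>x. B h i x + B h' i x)"
      using A by (simp_all add: P_map_apply LSC_add pullback_add B_def)
  qed
  have "Fm (\<lambda>x. h x + h' x) \<le> Fm h + Fp h'" if "h \<in> LSC L" "h' \<in> LSC L" for h h'
    unfolding F_SUP_add[OF Fm(1) that]
  proof (rule SUP_least)
    fix i assume i: "i \<in> I"
    have "Fm (\<lambda>x. B h i x + B h' i x) \<le> Fm (B h i) + Fp (B h' i)" using i by (rule step)
    also have "\<dots> \<le> Fm h + Fp h'"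
      using B[OF i] B_le that by (intro add_mono prevision_mono[OF Fm(1)] prevision_mono[OF Fp(1)])
    finally show "Fm (\<lambda>x. B h i x + B h' i x) \<le> Fm h + Fp h'" .
  qed
  moreover have "Fm h + Fp h' \<le> Fp (\<lambda>x. h x + h' x)" if "h \<in> LSC L" "h' \<in> LSC L" for h h'
  proof -
    have "Fm h + Fp h' = (SUP i\<in>I. Fm (B h i)) + (SUP i\<in>I. Fp (B h' i))"
      using F_SUP[OF Fm(1) that(1)] F_SUP[OF Fp(1) that(2)] by simp
    also have "\<dots> = (SUP i\<in>I. Fm (B h i) + Fp (B h' i))"
    proof (rule SUP_add_directed_ennreal[symmetric])
      fix i j assume ij: "i \<in> I" "j \<in> I"
      then obtain k where "k \<in> I" "le i k" "le j k" using dir by (auto simp: directed_in_def)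
      then show "\<exists>k\<in>I. Fm (B h i) + Fp (B h' j) \<le> Fm (B h k) + Fp (B h' k)"
        using ij B B_mono
        by (intro bexI[of _ k] add_mono prevision_mono[OF Fm(1)] prevision_mono[OF Fp(1)]) auto
    qed
    also have "\<dots> \<le> (SUP i\<in>I. Fp (\<lambda>x. B h i x + B h' i x))"
      by (intro SUP_mono) (auto intro: step)
    also have "\<dots> = Fp (\<lambda>x. h x + h' x)" using F_SUP_add[OF Fp(1) that] by simp
    finally show ?thesis .
  qed
  ultimately show ?thesis using Fm Fp by (auto simp: fork_def)
qed

section \<open>The space of forks as a subspace of a product\<close>

lemma topspace_prevision_topology: "topspace (prevision_topology X S) = S"
  by (auto simp: prevision_topology_def)

lemma prevision_topology_Int:
  "prevision_topology X (S \<inter> T) = subtopology (prevision_topology X S) T"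
proof -
  let ?A = "prevision_topology X (S \<inter> T)" and ?B = "subtopology (prevision_topology X S) T"
  have top: "topspace ?A = topspace ?B" by (simp add: topspace_prevision_topology)
  have A: "openin ?A {F \<in> S \<inter> T. r < F h}" and S: "openin (prevision_topology X S) {F \<in> S. r < F h}"
    if "h \<in> LSC X" "r < \<infinity>" for h r
    using that unfolding prevision_topology_def by (auto intro!: topology_generated_by_Basis)
  have AS: "openin ?A (S \<inter> T)"
    unfolding prevision_topology_def by (auto intro!: topology_generated_by_Basis)
  have BS: "openin ?B (S \<inter> T)"
    using openin_topspace[of ?B] by (simp add: topspace_prevision_topology)
  have "continuous_map ?A (prevision_topology X S) id"
    unfolding prevision_topology_def[of X S]
  proof (rule continuous_on_generated_topo)
    fix U assume "U \<in> insert S {{F \<in> S. r < F h} |h r. h \<in> LSC X \<and> r < \<infinity>}"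
    then consider "U = S" | h r where "U = {F \<in> S. r < F h}" "h \<in> LSC X" "r < \<infinity>" by blast
    then show "openin ?A (id -` U \<inter> topspace ?A)"
    proof cases
      case 1
      have "id -` U \<inter> topspace ?A = S \<inter> T" using 1 by (auto simp: topspace_prevision_topology)
      then show ?thesis using AS by simp
    next
      case 2
      have "id -` U \<inter> topspace ?A = {F \<in> S \<inter> T. r < F h}"
        using 2 by (auto simp: topspace_prevision_topology)
      then show ?thesis using A[OF 2(2,3)] by simp
    qed
  qed (auto simp: topspace_prevision_topology)
  then have AB: "continuous_map ?A ?B id"
    by (auto simp: continuous_map_in_subtopology topspace_prevision_topology)
  have BA: "continuous_map ?B ?A id"
    unfolding prevision_topology_def[of X "S \<inter> T"]
  proof (rule continuous_on_generated_topo)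
    fix U assume "U \<in> insert (S \<inter> T) {{F \<in> S \<inter> T. r < F h} |h r. h \<in> LSC X \<and> r < \<infinity>}"
    then consider "U = S \<inter> T" | h r where "U = {F \<in> S \<inter> T. r < F h}" "h \<in> LSC X" "r < \<infinity>" by blast
    then show "openin ?B (id -` U \<inter> topspace ?B)"
    proof cases
      case 1
      have "id -` U \<inter> topspace ?B = S \<inter> T" using 1 by (auto simp: topspace_prevision_topology)
      then show ?thesis using BS by simp
    next
      case 2
      have "id -` U \<inter> topspace ?B = {F \<in> S. r < F h} \<inter> T"
        using 2 by (auto simp: topspace_prevision_topology)
      then show ?thesis using openin_subtopology_Int[OF S[OF 2(2,3)]] by simp
    qed
  qed (auto simp: topspace_prevision_topology)
  show ?thesis
    using topology_finer_continuous_id[OF top] topology_finer_continuous_id[OF top[symmetric]] AB BA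
    by (auto simp: topology_eq)
qed

lemma P_ADP_alt:
  "P_ADP b X = subtopology (prod_topology (P_DP b X) (P_AP b X)) {FF. fork X FF}"
proof -
  let ?D = "{F. decorated b X F}"
  have "P_DP b X = subtopology (P_DP Plain X) ?D" "P_AP b X = subtopology (P_AP Plain X) ?D"
    unfolding P_DP_def P_AP_def prevision_topology_Int[symmetric]
    by (auto intro!: arg_cong[where f = "prevision_topology X"])
  then show ?thesis
    unfolding P_ADP_def
    by (simp only: subtopology_Times[symmetric] subtopology_subtopology)
      (auto intro!: arg_cong[where f = "subtopology _"])
qed

section \<open>Projective limits of subspaces of products\<close>

text \<open>
  The inverse homeomorphism splits a compatible family of pairs into its two component families
  and applies the two given inverses.  The hypothesis on \<open>S\<close> is used in both directions: from left
  to right the family of projections lands in the subspaces \<open>T i\<close>, and from right to left the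
  inverse lands in \<open>S\<close>.
\<close>

lemma is_projective_limit_subspace_prod:
  fixes Z1 :: "'i \<Rightarrow> 'a topology" and Z2 :: "'i \<Rightarrow> 'b topology"
  assumes lim1: "is_projective_limit I le Z1 p1 Y1 q1"
    and lim2: "is_projective_limit I le Z2 p2 Y2 q2"
    and S: "\<And>y1 y2. y1 \<in> topspace Y1 \<Longrightarrow> y2 \<in> topspace Y2 \<Longrightarrow>
      (y1, y2) \<in> S \<longleftrightarrow> (\<forall>i\<in>I. (q1 i y1, q2 i y2) \<in> T i)"
  shows "is_projective_limit I le (\<lambda>i. subtopology (prod_topology (Z1 i) (Z2 i)) (T i))
    (\<lambda>i j. map_prod (p1 i j) (p2 i j))
    (subtopology (prod_topology Y1 Y2) S) (\<lambda>i. map_prod (q1 i) (q2 i))"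
proof -
  define Z where "Z = (\<lambda>i. subtopology (prod_topology (Z1 i) (Z2 i)) (T i))"
  define r where "r = (\<lambda>i j. map_prod (p1 i j) (p2 i j))"
  define Y where "Y = subtopology (prod_topology Y1 Y2) S"
  let ?L1 = "canonical_limit I le Z1 p1" and ?L2 = "canonical_limit I le Z2 p2"
    and ?L = "canonical_limit I le Z r"
  define f1 where "f1 = (\<lambda>y. \<lambda>i\<in>I. q1 i y)"
  define f2 where "f2 = (\<lambda>y. \<lambda>i\<in>I. q2 i y)"
  define f where "f = (\<lambda>y. \<lambda>i\<in>I. map_prod (q1 i) (q2 i) y)"
  obtain g1 where g1: "homeomorphic_maps Y1 ?L1 f1 g1"
    using lim1 unfolding is_projective_limit_def f1_def homeomorphic_map_maps by blast
  obtain g2 where g2: "homeomorphic_maps Y2 ?L2 f2 g2"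
    using lim2 unfolding is_projective_limit_def f2_def homeomorphic_map_maps by blast
  define u1 :: "('i \<Rightarrow> 'a \<times> 'b) \<Rightarrow> 'i \<Rightarrow> 'a" where "u1 = (\<lambda>z. \<lambda>i\<in>I. fst (z i))"
  define u2 :: "('i \<Rightarrow> 'a \<times> 'b) \<Rightarrow> 'i \<Rightarrow> 'b" where "u2 = (\<lambda>z. \<lambda>i\<in>I. snd (z i))"
  define g where "g = (\<lambda>z. (g1 (u1 z), g2 (u2 z)))"
  have f1: "continuous_map Y1 ?L1 f1" and f2: "continuous_map Y2 ?L2 f2"
    and g1c: "continuous_map ?L1 Y1 g1" and g2c: "continuous_map ?L2 Y2 g2"
    and gf1: "\<And>y. y \<in> topspace Y1 \<Longrightarrow> g1 (f1 y) = y" and gf2: "\<And>y. y \<in> topspace Y2 \<Longrightarrow> g2 (f2 y) = y"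
    and fg1: "\<And>z. z \<in> topspace ?L1 \<Longrightarrow> f1 (g1 z) = z" and fg2: "\<And>z. z \<in> topspace ?L2 \<Longrightarrow> f2 (g2 z) = z"
    using g1 g2 by (auto simp: homeomorphic_maps_def)
  have q1: "continuous_map Y1 (Z1 i) (q1 i)" if "i \<in> I" for i
    using continuous_map_compose[OF f1 continuous_map_canonical_limit_projection[OF that]] that
    by (simp add: o_def f1_def)
  have q2: "continuous_map Y2 (Z2 i) (q2 i)" if "i \<in> I" for i
    using continuous_map_compose[OF f2 continuous_map_canonical_limit_projection[OF that]] that
    by (simp add: o_def f2_def)
  have topY: "y \<in> topspace Y \<longleftrightarrow> fst y \<in> topspace Y1 \<and> snd y \<in> topspace Y2 \<and> y \<in> S" for y
    by (auto simp: Y_def topspace_subtopology mem_Times_iff)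
  have topZ: "z \<in> topspace (Z i) \<longleftrightarrow> fst z \<in> topspace (Z1 i) \<and> snd z \<in> topspace (Z2 i) \<and> z \<in> T i" for z i
    by (auto simp: Z_def topspace_subtopology mem_Times_iff)

  have "continuous_map Y ?L f"
    unfolding canonical_limit_def continuous_map_in_subtopology
  proof
    have "continuous_map Y (Z i) (\<lambda>y. map_prod (q1 i) (q2 i) y)" if "i \<in> I" for i
      unfolding Z_def continuous_map_in_subtopology
    proof
      have "continuous_map Y (prod_topology (Z1 i) (Z2 i)) (\<lambda>y. (q1 i (fst y), q2 i (snd y)))"
        unfolding Y_def
        by (intro continuous_map_from_subtopology continuous_map_pairedI
            continuous_map_compose[OF continuous_map_fst q1[OF that], unfolded o_def]
            continuous_map_compose[OF continuous_map_snd q2[OF that], unfolded o_def])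
      then show "continuous_map Y (prod_topology (Z1 i) (Z2 i)) (map_prod (q1 i) (q2 i))"
        by (simp add: map_prod_def split_beta')
      show "map_prod (q1 i) (q2 i) \<in> topspace Y \<rightarrow> T i"
        using S that by (auto simp: topY)
    qed
    then show c: "continuous_map Y (product_topology Z I) f"
      unfolding f_def by (auto simp: continuous_map_componentwise)
    show "f \<in> topspace Y \<rightarrow> {x \<in> \<Pi>\<^sub>E i\<in>I. topspace (Z i). \<forall>i\<in>I. \<forall>j\<in>I. le i j \<longrightarrow> r i j (x j) = x i}"
    proof
      fix y assume y: "y \<in> topspace Y"
      have "f y \<in> (\<Pi>\<^sub>E i\<in>I. topspace (Z i))"
        using continuous_map_image_subset_topspace[OF c] y by auto
      moreover have "f1 (fst y) \<in> topspace ?L1" "f2 (snd y) \<in> topspace ?L2"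
        using continuous_map_image_subset_topspace[OF f1] continuous_map_image_subset_topspace[OF f2] y
        by (auto simp: topY)
      ultimately show "f y \<in> {x \<in> \<Pi>\<^sub>E i\<in>I. topspace (Z i). \<forall>i\<in>I. \<forall>j\<in>I. le i j \<longrightarrow> r i j (x j) = x i}"
        by (auto simp: canonical_limit_topspace f_def f1_def f2_def r_def map_prod_def split_beta)
    qed
  qed
  moreover have u1: "continuous_map ?L ?L1 u1" and u2: "continuous_map ?L ?L2 u2"
  proof -
    have z: "continuous_map ?L (prod_topology (Z1 i) (Z2 i)) (\<lambda>z. z i)" if "i \<in> I" for i
      using continuous_map_canonical_limit_projection[OF that, of le Z r]
      unfolding Z_def by (simp add: continuous_map_in_subtopology)
    have "continuous_map ?L (product_topology Z1 I) u1" "continuous_map ?L (product_topology Z2 I) u2"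
      unfolding u1_def u2_def
      using continuous_map_compose[OF z continuous_map_fst] continuous_map_compose[OF z continuous_map_snd]
      by (auto simp: continuous_map_componentwise o_def)
    then show "continuous_map ?L ?L1 u1" "continuous_map ?L ?L2 u2"
      unfolding canonical_limit_def[of _ _ Z1] canonical_limit_def[of _ _ Z2]
      by (auto simp: continuous_map_in_subtopology canonical_limit_topspace topZ u1_def u2_def r_def
          PiE_iff map_prod_def split_beta prod_eq_iff)
  qed
  moreover have fg: "f (g z) = z" and gS: "g z \<in> S" if z: "z \<in> topspace ?L" for z
  proof -
    have uz: "u1 z \<in> topspace ?L1" "u2 z \<in> topspace ?L2"
      using continuous_map_image_subset_topspace[OF u1] continuous_map_image_subset_topspace[OF u2] z
      by auto
    then have *: "q1 i (g1 (u1 z)) = fst (z i)" "q2 i (g2 (u2 z)) = snd (z i)" if "i \<in> I" for i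
      using fun_cong[OF fg1[OF uz(1)], of i] fun_cong[OF fg2[OF uz(2)], of i] that
      by (simp_all add: f1_def f2_def u1_def u2_def)
    then show "f (g z) = z"
      using z by (auto simp: f_def g_def canonical_limit_topspace PiE_iff extensional_def fun_eq_iff)
    have "g1 (u1 z) \<in> topspace Y1" "g2 (u2 z) \<in> topspace Y2"
      using continuous_map_image_subset_topspace[OF g1c] continuous_map_image_subset_topspace[OF g2c] uz
      by auto
    then show "g z \<in> S"
      using S z * by (auto simp: g_def canonical_limit_topspace PiE_iff topZ)
  qed
  moreover have "continuous_map ?L Y g"
    unfolding Y_def continuous_map_in_subtopology g_def
    using gS continuous_map_compose[OF u1 g1c] continuous_map_compose[OF u2 g2c]
    by (auto simp: o_def g_def intro!: continuous_map_pairedI)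
  moreover have "g (f y) = y" if y: "y \<in> topspace Y" for y
  proof -
    have "u1 (f y) = f1 (fst y)" "u2 (f y) = f2 (snd y)"
      by (auto simp: u1_def u2_def f_def f1_def f2_def)
    then show ?thesis using y gf1 gf2 by (simp add: g_def topY)
  qed
  ultimately have "homeomorphic_maps Y ?L f g"
    by (simp add: homeomorphic_maps_def)
  then show ?thesis
    unfolding is_projective_limit_def homeomorphic_map_maps Y_def f_def Z_def r_def by blast
qed

lemma is_projective_limit_projection_in:
  assumes "is_projective_limit I le Z p Y q" "i \<in> I" "y \<in> topspace Y"
  shows "q i y \<in> topspace (Z i)"
proof -
  have "(\<lambda>i\<in>I. q i y) \<in> topspace (canonical_limit I le Z p)"
    using assms by (auto simp: is_projective_limit_def dest: homeomorphic_imp_surjective_map)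
  then show ?thesis using assms(2) by (auto simp: canonical_limit_topspace PiE_iff)
qed

section \<open>Forks on a projective limit\<close>

theorem theorem14p2:
  fixes b :: decoration
    and I :: "'i set"
    and le :: "'i \<Rightarrow> 'i \<Rightarrow> bool"
    and X :: "'i \<Rightarrow> 'a topology"
    and p :: "'i \<Rightarrow> 'i \<Rightarrow> 'a \<Rightarrow> 'a"
    and L :: "('i \<Rightarrow> 'a) topology"
  assumes "projective_system I le X p"
    and "L = canonical_limit I le X p"
    and "is_projective_limit I le (\<lambda>i. P_DP b (X i)) (\<lambda>i j. P_map (X j) (X i) (p i j))
           (P_DP b L) (\<lambda>i. P_map L (X i) (\<lambda>x. x i))"
    and "is_projective_limit I le (\<lambda>i. P_AP b (X i)) (\<lambda>i j. P_map (X j) (X i) (p i j))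
           (P_AP b L) (\<lambda>i. P_map L (X i) (\<lambda>x. x i))"
  shows "is_projective_limit I le (\<lambda>i. P_ADP b (X i)) (\<lambda>i j. fork_map (X j) (X i) (p i j))
           (P_ADP b L) (\<lambda>i. fork_map L (X i) (\<lambda>x. x i))"
  unfolding P_ADP_alt fork_map_def
proof (rule is_projective_limit_subspace_prod[OF assms(3,4)])
  fix Fm Fp assume F: "Fm \<in> topspace (P_DP b L)" "Fp \<in> topspace (P_AP b L)"
  have F_L: "prevision L Fm" "superlinear L Fm" "prevision L Fp" "sublinear L Fp"
    using F by (simp_all add: P_DP_def P_AP_def topspace_prevision_topology)
  have F_X: "prevision (X i) (P_map L (X i) (\<lambda>x. x i) Fm)" "superlinear (X i) (P_map L (X i) (\<lambda>x. x i) Fm)"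
    "prevision (X i) (P_map L (X i) (\<lambda>x. x i) Fp)" "sublinear (X i) (P_map L (X i) (\<lambda>x. x i) Fp)"
    if "i \<in> I" for i
    using is_projective_limit_projection_in[OF assms(3) that F(1)]
      is_projective_limit_projection_in[OF assms(4) that F(2)]
    by (simp_all add: P_DP_def P_AP_def topspace_prevision_topology)
  show "(Fm, Fp) \<in> {FF. fork L FF} \<longleftrightarrow>
      (\<forall>i\<in>I. (P_map L (X i) (\<lambda>x. x i) Fm, P_map L (X i) (\<lambda>x. x i) Fp) \<in> {FF. fork (X i) FF})"
    unfolding mem_Collect_eq
  proof (intro iffI ballI)
    fix i assume "fork L (Fm, Fp)" and i: "i \<in> I"
    moreover have "continuous_map L (X i) (\<lambda>x. x i)"
      unfolding assms(2) using i by (rule continuous_map_canonical_limit_projection)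
    ultimately show "fork (X i) (P_map L (X i) (\<lambda>x. x i) Fm, P_map L (X i) (\<lambda>x. x i) Fp)"
      by (intro fork_P_map F_X)
  next
    assume "\<forall>i\<in>I. fork (X i) (P_map L (X i) (\<lambda>x. x i) Fm, P_map L (X i) (\<lambda>x. x i) Fp)"
    then show "fork L (Fm, Fp)"
      using fork_canonical_limitI[OF assms(1), folded assms(2), OF F_L] by blast
  qed
qed

end
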